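(* Let $p$ be a prime. There is no set $S\subseteq\mathbb{F}_p^2$ of cardinality divisible by $p$ that has exactly two special directions.
   Context: $\mathbb{F}_p$ is the field with $p$ elements. A direction is an equivalence class of nonzero vectors of $\mathbb{F}_p^2$ under multiplication by nonzero scalars; there are $p+1$ directions, and each corresponds to a class of $p$ parallel affine lines. A set $S\subseteq\mathbb{F}_p^2$ is equidistributed in a direction if all $p$ lines parallel to that direction intersect $S$ in the same number of points. A direction is called special for $S$ if $S$ is not equidistributed in it. *)

theory Defs
  imports "HOL-Analysis.Cartesian_Space" "HOL-Computational_Algebra.Primes"
begin

(* The plane over a field is the type 'a ^ 2, with scalar multiplication *s. *)

definition direction_rel :: "(('a::field ^ 2) \<times> ('a ^ 2)) set" where
  "direction_rel = {(u, v). u \<noteq> 0 \<and> v \<noteq> 0 \<and> (\<exists>c. c \<noteq> 0 \<and> v = c *s u)}"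

lemma equiv_direction_rel: "equiv (UNIV - {0}) (direction_rel :: (('a::field ^ 2) \<times> ('a ^ 2)) set)"
proof (rule equivI)
  show "direction_rel \<subseteq> (UNIV - {0}) \<times> (UNIV - {0 :: 'a ^ 2})"
    by (auto simp: direction_rel_def)
  show "refl_on (UNIV - {0 :: 'a ^ 2}) direction_rel"
    by (auto simp: refl_on_def direction_rel_def intro!: exI[of _ 1])
  show "sym (direction_rel :: (('a ^ 2) \<times> ('a ^ 2)) set)"
  proof (rule symI)
    fix u v :: "'a ^ 2"
    assume "(u, v) \<in> direction_rel"
    then obtain c where "u \<noteq> 0" "v \<noteq> 0" "c \<noteq> 0" "v = c *s u"
      by (auto simp: direction_rel_def)
    then have "u = inverse c *s v" "inverse c \<noteq> 0"
      by (simp_all add: vector_smult_assoc)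
    with \<open>u \<noteq> 0\<close> \<open>v \<noteq> 0\<close> show "(v, u) \<in> direction_rel"
      unfolding direction_rel_def by blast
  qed
  show "trans (direction_rel :: (('a ^ 2) \<times> ('a ^ 2)) set)"
  proof (rule transI)
    fix u v w :: "'a ^ 2"
    assume "(u, v) \<in> direction_rel" "(v, w) \<in> direction_rel"
    then obtain c d where "u \<noteq> 0" "w \<noteq> 0" "c \<noteq> 0" "d \<noteq> 0" "v = c *s u" "w = d *s v"
      by (auto simp: direction_rel_def)
    then have "w = (d * c) *s u" "d * c \<noteq> 0"
      by (simp_all add: vector_smult_assoc)
    with \<open>u \<noteq> 0\<close> \<open>w \<noteq> 0\<close> show "(u, w) \<in> direction_rel"
      unfolding direction_rel_def by blast
  qed
qed

definition directions :: "('a::field ^ 2) set set" where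
  "directions = (UNIV - {0}) // direction_rel"

definition parallel_lines :: "('a::field ^ 2) set \<Rightarrow> ('a ^ 2) set set" where
  "parallel_lines d = {range (\<lambda>t. a + t *s v) | a v. v \<in> d}"

definition equidistributed :: "('a::field ^ 2) set \<Rightarrow> ('a ^ 2) set \<Rightarrow> bool" where
  "equidistributed S d \<longleftrightarrow> (\<exists>k. \<forall>L \<in> parallel_lines d. card (S \<inter> L) = k)"

definition special_directions :: "('a::field ^ 2) set \<Rightarrow> ('a ^ 2) set set" where
  "special_directions S = {d \<in> directions. \<not> equidistributed S d}"

end

(* Count incidences along the pencil of lines through a point P. Every line in a non-special
   direction contributes a number independent of P, so if d and e are the only special directions
   then (points of S on the d-line through P) + (points of S on the e-line through P) equals
   C + (number of directions - 1) * [P in S]. If the first summand takes two values m > n, then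
   each e-line meets a d-line with m points and one with n points, which forces the e-line
   to carry C - n points; hence S is equidistributed in direction e. *)
theory Submission
  imports Defs
begin

text \<open>A direction \<open>d\<close> contains only nonzero vectors, so the translate of
  \<open>d\<close> by \<open>P\<close> is the line punctured at \<open>P\<close>, and
  \<open>P\<close> has to be added back. No representative vector is chosen.\<close>

definition line_through :: "'a::field ^ 2 \<Rightarrow> ('a ^ 2) set \<Rightarrow> ('a ^ 2) set" where
  "line_through P d = insert P ((+) P ` d)"

lemma directions_eq_multiples:
  assumes "d \<in> directions" "v \<in> d"
  shows "v \<noteq> 0" "d = {c *s v | c. c \<noteq> 0}"
proof -
  obtain u where u: "u \<noteq> 0" "d = direction_rel `` {u}"
    using assms(1) by (auto simp: directions_def quotient_def)
  with assms(2) have uv: "(u, v) \<in> direction_rel" by simp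
  then show "v \<noteq> 0" by (simp add: direction_rel_def)
  have "d = direction_rel `` {v}"
    using equiv_class_eq[OF equiv_direction_rel uv] u by simp
  with \<open>v \<noteq> 0\<close> show "d = {c *s v | c. c \<noteq> 0}"
    by (auto simp: direction_rel_def)
qed

lemma directions_nonempty:
  assumes "d \<in> directions"
  obtains v where "v \<in> d"
  using in_quotient_imp_non_empty[OF equiv_direction_rel] assms
  unfolding directions_def by blast

lemma Union_directions: "\<Union> directions = (UNIV - {0 :: 'a::field ^ 2})"
  unfolding directions_def by (rule Union_quotient[OF equiv_direction_rel])

lemma directions_disjoint:
  assumes "d \<in> directions" "e \<in> directions" "d \<noteq> e"
  shows "d \<inter> e = {}"
  using quotient_disj[OF equiv_direction_rel] assms unfolding directions_def by blast

lemma line_through_eq_range: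
  assumes "d \<in> directions" "v \<in> d"
  shows "line_through P d = range (\<lambda>t. P + t *s v)"
proof -
  have "range (\<lambda>t. P + t *s v) = insert (P + 0 *s v) ((\<lambda>t. P + t *s v) ` (UNIV - {0}))"
    by (metis UNIV_I image_insert insert_Diff)
  also have "\<dots> = line_through P d"
    unfolding line_through_def using directions_eq_multiples(2)[OF assms] by auto
  finally show ?thesis by simp
qed

text \<open>All representatives of \<open>d\<close> span the same line through a given point, so
  quantifying over lines reduces to quantifying over base points.\<close>

lemma parallel_lines_eq:
  assumes "d \<in> directions"
  shows "parallel_lines d = range (\<lambda>P. line_through P d)"
proof -
  obtain v where "v \<in> d" using directions_nonempty[OF assms] .
  then show ?thesis
    unfolding parallel_lines_def using line_through_eq_range[OF assms] by (auto; blast)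
qed

lemma equidistributed_iff:
  assumes "d \<in> directions"
  shows "equidistributed S d \<longleftrightarrow> (\<exists>k. \<forall>P. card (S \<inter> line_through P d) = k)"
  unfolding equidistributed_def parallel_lines_eq[OF assms] by auto

text \<open>Moving the base point along the line only shifts the parameter. This lets a count at a
  meeting point be read as a count for the two lines that meet there.\<close>

lemma line_through_eqI:
  assumes "d \<in> directions" "X \<in> line_through P d"
  shows "line_through X d = line_through P d"
proof -
  obtain v where v: "v \<in> d" using directions_nonempty[OF assms(1)] .
  obtain s where s: "X = P + s *s v"
    using assms line_through_eq_range[OF assms(1) v] by auto
  have "X + t *s v = P + (s + t) *s v" "P + t *s v = X + (t - s) *s v" for t
    unfolding s by (simp_all add: algebra_simps)
  then show ?thesis
    unfolding line_through_eq_range[OF assms(1) v]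
    by (intro subset_antisym image_subsetI) (metis rangeI)+
qed

lemma line_through_meet:
  fixes P Q :: "'a::field ^ 2"
  assumes "d \<in> directions" "e \<in> directions" "d \<noteq> e"
  obtains X where "X \<in> line_through P d" "X \<in> line_through Q e"
proof -
  obtain v where v: "v \<in> d" using directions_nonempty[OF assms(1)] .
  obtain w where w: "w \<in> e" using directions_nonempty[OF assms(2)] .
  have v0: "v \<noteq> 0" and w0: "w \<noteq> 0"
    using directions_eq_multiples(1) assms v w by auto
  \<comment> \<open>A nonzero \<open>c\<close> would put \<open>w\<close> into \<open>d\<close>,
    which is disjoint from \<open>e\<close>; \<open>c = 0\<close> contradicts
    \<open>w0\<close>.\<close>
  have nm: "w \<noteq> c *s v" for c
    using directions_eq_multiples(2)[OF assms(1) v] directions_disjoint[OF assms] w w0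
    by (cases "c = 0") auto
  define D where "D = v$1 * w$2 - v$2 * w$1"
  have "D \<noteq> 0"
  proof
    assume D0: "D = 0"
    show False
    proof (cases "v$1 = 0")
      case True
      with v0 have "v$2 \<noteq> 0" by (auto simp: vec_eq_iff forall_2)
      with True D0 have "w = (w$2 / v$2) *s v"
        by (auto simp: vec_eq_iff forall_2 D_def)
      with nm show False by blast
    next
      case False
      with D0 have "w = (w$1 / v$1) *s v"
        by (auto simp: vec_eq_iff forall_2 D_def field_simps)
      with nm show False by blast
    qed
  qed
  define z where "z = Q - P"
  \<comment> \<open>Cramer's rule for \<open>s *s v - t *s w = z\<close>, whose solution gives the
    common point.\<close>
  define s where "s = (z$1 * w$2 - z$2 * w$1) / D"
  define t where "t = (z$1 * v$2 - z$2 * v$1) / D"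
  \<comment> \<open>Multiplying by \<open>D\<close> clears the denominators and leaves a polynomial
    identity in each coordinate.\<close>
  have "D * (s * v$i) = D * (z$i + t * w$i)" for i
  proof -
    have "D * s = z$1 * w$2 - z$2 * w$1" "D * t = z$1 * v$2 - z$2 * v$1"
      using \<open>D \<noteq> 0\<close> by (simp_all add: s_def t_def)
    then have "(D * s) * v$i = (z$1 * w$2 - z$2 * w$1) * v$i"
      "D * z$i + (D * t) * w$i = D * z$i + (z$1 * v$2 - z$2 * v$1) * w$i"
      by simp_all
    moreover have "(z$1 * w$2 - z$2 * w$1) * v$i = D * z$i + (z$1 * v$2 - z$2 * v$1) * w$i"
      using exhaust_2[of i] by (auto simp: D_def algebra_simps)
    ultimately show ?thesis
      by (simp only: distrib_left mult.assoc)
  qed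
  then have "s *s v = z + t *s w"
    using \<open>D \<noteq> 0\<close> by (simp add: vec_eq_iff)
  then have "P + s *s v = Q + t *s w" by (simp add: z_def algebra_simps)
  then have "P + s *s v \<in> line_through P d" "P + s *s v \<in> line_through Q e"
    using line_through_eq_range[OF assms(1) v] line_through_eq_range[OF assms(2) w]
    by (metis rangeI)+
  then show thesis using that by blast
qed

text \<open>The lines through \<open>P\<close>, punctured at \<open>P\<close>, partition the rest of
  the plane, while \<open>P\<close> itself lies on every one of them and is counted once per
  direction.\<close>

lemma sum_card_line_through:
  fixes S :: "('a::{field, finite} ^ 2) set"
  shows "(\<Sum>d\<in>directions. card (S \<inter> line_through P d))
    = card (directions :: ('a ^ 2) set set) * of_bool (P \<in> S) + card (S - {P})"
proof -
  have split: "card (S \<inter> line_through P d) = of_bool (P \<in> S) + card (S \<inter> (+) P ` d)"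
    if "d \<in> directions" for d
  proof -
    have "P \<notin> (+) P ` d" using directions_eq_multiples(1)[OF that] by auto
    then show ?thesis by (auto simp: line_through_def)
  qed
  have "S - {P} = (\<Union>d\<in>directions. S \<inter> (+) P ` d)"
  proof -
    have "(\<Union>d\<in>directions. S \<inter> (+) P ` d) = S \<inter> (+) P ` (UNIV - {0})"
      unfolding Union_directions[symmetric] by auto
    also have "(+) P ` (UNIV - {0}) = UNIV - {P}"
      by (simp add: image_set_diff)
    finally show ?thesis by auto
  qed
  moreover have "card (\<Union>d\<in>directions. S \<inter> (+) P ` d) = (\<Sum>d\<in>directions. card (S \<inter> (+) P ` d))"
  proof (intro card_UN_disjoint ballI impI)
    fix d e :: "('a ^ 2) set"
    assume "d \<in> directions" "e \<in> directions" "d \<noteq> e"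
    then have "d \<inter> e = {}" by (rule directions_disjoint)
    then show "(S \<inter> (+) P ` d) \<inter> (S \<inter> (+) P ` e) = {}" by auto
  qed simp_all
  ultimately show ?thesis
    by (simp add: split sum.distrib)
qed

text \<open>Every direction other than \<open>d\<close> and \<open>e\<close> contributes a constant
  to the pencil count at \<open>P\<close>; moving these constants to the other side leaves the pair.
  Integers keep the subtraction exact.\<close>

lemma special_pair_sum:
  fixes S :: "('a::{field, finite} ^ 2) set"
  assumes "special_directions S = {d, e}" "d \<noteq> e"
  obtains C q :: int where "q > 0"
    "\<And>P. int (card (S \<inter> line_through P d)) + int (card (S \<inter> line_through P e))
      = C + q * of_bool (P \<in> S)"
proof -
  let ?D = "directions :: ('a ^ 2) set set" and ?N = "\<lambda>P d. card (S \<inter> line_through P d)"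
  have sub: "{d, e} \<subseteq> ?D"
    using assms(1) by (auto simp: special_directions_def)
  then have "2 \<le> card ?D" using card_mono[of ?D "{d, e}"] assms(2) by simp
  have "\<exists>k. \<forall>P. ?N P f = k" if "f \<in> ?D - {d, e}" for f
    using that assms(1) equidistributed_iff[of f S] by (auto simp: special_directions_def)
  then obtain k where k: "\<And>f P. f \<in> ?D - {d, e} \<Longrightarrow> ?N P f = k f"
    by metis
  \<comment> \<open>The coefficient is \<open>card ?D - 1\<close> because \<open>P\<close> is
    counted in every direction but removed once in \<open>S - {P}\<close>. It is positive, since
    \<open>d\<close> and \<open>e\<close> are two directions.\<close>
  have "int (?N P d) + int (?N P e)
      = (int (card S) - int (sum k (?D - {d, e}))) + (int (card ?D) - 1) * of_bool (P \<in> S)" for P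
  proof -
    have "(\<Sum>f\<in>?D. ?N P f) = sum k (?D - {d, e}) + (?N P d + ?N P e)"
      using sum.subset_diff[OF sub, of "?N P"] assms(2) k by simp
    then have "int (sum k (?D - {d, e}) + (?N P d + ?N P e))
        = int (card ?D * of_bool (P \<in> S) + card (S - {P}))"
      using sum_card_line_through[of S P] by metis
    moreover have "int (card (S - {P})) = int (card S) - of_bool (P \<in> S)"
      using card_gt_0_iff[of S] by (auto simp: of_nat_diff)
    ultimately show ?thesis
      by (simp only: of_nat_add of_nat_mult of_nat_of_bool left_diff_distrib mult_1)
  qed
  then show thesis
    using that[of "int (card ?D) - 1"] \<open>2 \<le> card ?D\<close> by simp
qed

lemma card_special_directions_neq_2:
  fixes S :: "('a::{field, finite} ^ 2) set"
  shows "card (special_directions S) \<noteq> 2"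
proof
  let ?N = "\<lambda>P d. int (card (S \<inter> line_through P d))"
  assume "card (special_directions S) = 2"
  then obtain d e where de: "special_directions S = {d, e}" "d \<noteq> e"
    by (auto simp: card_2_iff)
  then have dir: "d \<in> directions" "e \<in> directions"
    and special: "\<not> equidistributed S d" "\<not> equidistributed S e"
    by (auto simp: special_directions_def)
  obtain C q where q: "q > 0" and N: "\<And>P. ?N P d + ?N P e = C + q * of_bool (P \<in> S)"
    using special_pair_sum[OF de] by blast
  have "\<exists>P Q. ?N P d > ?N Q d"
    using special(1) unfolding equidistributed_iff[OF dir(1)]
    by (metis linorder_less_linear of_nat_less_iff)
  then obtain P Q where PQ: "?N P d > ?N Q d" by blast
  have "?N R e = C - ?N Q d" for R
  proof -
    obtain X where X: "X \<in> line_through P d" "X \<in> line_through R e"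
      using line_through_meet[OF dir de(2)] .
    obtain Y where Y: "Y \<in> line_through Q d" "Y \<in> line_through R e"
      using line_through_meet[OF dir de(2)] .
    have "?N P d + ?N R e = C + q * of_bool (X \<in> S)"
      using N[of X] X line_through_eqI dir by metis
    moreover have "?N Q d + ?N R e = C + q * of_bool (Y \<in> S)"
      using N[of Y] Y line_through_eqI dir by metis
    \<comment> \<open>Subtracting the two equations gives
      \<open>q * (of_bool (X \<in> S) - of_bool (Y \<in> S)) > 0\<close> over the integers, so
      \<open>X \<in> S\<close> and \<open>Y \<notin> S\<close>; the second equation then yields the
      value, which does not depend on \<open>R\<close>.\<close>
    ultimately show ?thesis using PQ q by (auto split: if_splits simp: of_bool_def)
  qed
  then have "equidistributed S e"
    unfolding equidistributed_iff[OF dir(2)] by (metis of_nat_eq_iff)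
  with special(2) show False ..
qed

theorem mainTheorem2:
  fixes p :: nat
  assumes "prime p" and "CARD('a::{field, finite}) = p"
  shows "\<not> (\<exists>S :: ('a ^ 2) set. p dvd card S \<and> card (special_directions S) = 2)"
  using card_special_directions_neq_2 by blast

end
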